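(* Suppose that $\mathcal{D}$ is a semi-Ramsey ultrafilter on $\bigcup_{i<\omega}\{i\}\times(i+1)$. Then the following are equivalent: (a) $\mathcal{D}$ is almost Ramsey; (b) Player I has no winning strategy in the game $G^{aR}(\mathcal{D})$; (c) for every $m,L\in\omega$ and every colouring $f:\bigcup_{i<\omega}[\{i\}\times(i+1)]^{\le m}\to L$, Player I has no winning strategy in the game $G^{sR}_f(\mathcal{D})$.
   Context: Let $I=\bigcup_{i<\omega}\{i\}\times(i+1)$ and $\mathcal{D}$ a filter on $I$. Game $G^{sR}(\mathcal{D})$: at move $n$, Player I plays $A_n\in\mathcal{D}$, Player II answers with $i_n\in\omega$ and $a_n\in[A_n\cap(\{i_n\}\times(i_n+1))]^{\le n}$; Player I wins iff $\bigcup_n a_n\notin\mathcal{D}$. Game $G^{aR}(\mathcal{D})$: at move $n$, Player I chooses $A_n\in\mathcal{D}$, $L_n<\omega$ and $f_n:\bigcup_i[\{i\}\times(i+1)]^{\le n}\to L_n$; Player II answers with $i_n\in\omega$ and $a_n\in[A_n\cap(\{i_n\}\times(i_n+1))]^{\le n}$ homogeneous for $f_n$ (i.e. $f_n\restriction[a_n]^k$ constant for every $k\le n$); Player I wins iff $\bigcup_n a_n\notin\mathcal{D}$. For a colouring $f:\bigcup_i[\{i\}\times(i+1)]^{\le m}\to L$, the game $G^{sR}_f(\mathcal{D})$ has the rules of $G^{sR}(\mathcal{D})$ except that the sets $a_n$ chosen by Player II must additionally be homogeneous for $f$ (i.e. $f\restriction[a_n]^k$ constant for each $k\le m$). $\mathcal{D}$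 is semi-Ramsey if Player I has no winning strategy in $G^{sR}(\mathcal{D})$; it is almost Ramsey if it is semi-Ramsey and for every $n,L<\omega$ and every $f:\bigcup_i[\{i\}\times(i+1)]^{\le n}\to L$ there is $A\in\mathcal{D}$ with $f\restriction[A\cap(\{i\}\times(i+1))]^k$ constant for all $i$ and all $k\le n$. *)

theory Defs
  imports "HOL-Library.FuncSet" "HOL-Library.Ramsey" "HOL-Analysis.Abstract_Topology_2"
begin

text \<open>As usual in set theory, \<open>n = {0, \<dots>, n - 1}\<close>, so \<open>{i} \<times> (i + 1)\<close> is \<open>{i} \<times> {..i}\<close>.\<close>

definition tri_column :: "nat \<Rightarrow> (nat \<times> nat) set" where
  "tri_column i = {i} \<times> {..i}"

definition tri_index :: "(nat \<times> nat) set" where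
  "tri_index = (\<Union>i. tri_column i)"

definition nsets_le :: "'a set \<Rightarrow> nat \<Rightarrow> 'a set set" where
  "nsets_le A n = (\<Union>k\<le>n. [A]\<^bsup>k\<^esup>)"

text \<open>
  Library filters live on a whole type. A filter on a subset \<open>X\<close> of the type is a filter
  below \<open>principal X\<close>; its members as a family of subsets of \<open>X\<close> are \<open>members_on X D\<close>.
\<close>

definition members_on :: "'a set \<Rightarrow> 'a filter \<Rightarrow> 'a set set" where
  "members_on X D = {A. A \<subseteq> X \<and> (\<forall>\<^sub>F x in D. x \<in> A)}"

definition ultrafilter_on :: "'a set \<Rightarrow> 'a filter \<Rightarrow> bool" where
  "ultrafilter_on X D \<longleftrightarrow> D \<le> principal X \<and> D \<noteq> bot \<and>
     (\<forall>A\<subseteq>X. A \<in> members_on X D \<or> X - A \<in> members_on X D)"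

definition colourings :: "nat \<Rightarrow> nat \<Rightarrow> ((nat \<times> nat) set \<Rightarrow> nat) set" where
  "colourings n L = (\<Union>i. nsets_le (tri_column i) n) \<rightarrow> {..<L}"

definition homogeneous :: "('a set \<Rightarrow> nat) \<Rightarrow> nat \<Rightarrow> 'a set \<Rightarrow> bool" where
  "homogeneous f n a \<longleftrightarrow> (\<forall>k\<le>n. f constant_on [a]\<^bsup>k\<^esup>)"

text \<open>
  Games of length \<open>\<omega>\<close>: \<open>M n\<close> is the set of legal moves of Player I at move \<open>n\<close>, \<open>R n x\<close> the set
  of legal answers of Player II to \<open>x\<close> at move \<open>n\<close>, and \<open>W\<close> the set of sequences of answers
  with which Player I wins. Player I's own past moves are determined by the strategy and the past
  answers, so a strategy takes only the list of past answers (in order of play) as its argument.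
\<close>

definition winning_strategy_I ::
  "(nat \<Rightarrow> 'x set) \<Rightarrow> (nat \<Rightarrow> 'x \<Rightarrow> 'y set) \<Rightarrow> (nat \<Rightarrow> 'y) set \<Rightarrow> ('y list \<Rightarrow> 'x) \<Rightarrow> bool" where
  "winning_strategy_I M R W \<sigma> \<longleftrightarrow>
     (\<forall>ys. (\<forall>n<length ys. ys ! n \<in> R n (\<sigma> (take n ys))) \<longrightarrow> \<sigma> ys \<in> M (length ys)) \<and>
     (\<forall>y. (\<forall>n. y n \<in> R n (\<sigma> (map y [0..<n]))) \<longrightarrow> y \<in> W)"

type_synonym answer = "nat \<times> (nat \<times> nat) set"

definition sR_answers :: "nat \<Rightarrow> (nat \<times> nat) set \<Rightarrow> answer set" where
  "sR_answers n A = {(i, a). a \<in> nsets_le (A \<inter> tri_column i) n}"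

definition wins_I :: "(nat \<times> nat) filter \<Rightarrow> (nat \<Rightarrow> answer) set" where
  "wins_I D = {y. (\<Union>n. snd (y n)) \<notin> members_on tri_index D}"

definition sR_winning_strategy ::
  "(nat \<times> nat) filter \<Rightarrow> (answer list \<Rightarrow> (nat \<times> nat) set) \<Rightarrow> bool" where
  "sR_winning_strategy D =
     winning_strategy_I (\<lambda>n. members_on tri_index D) sR_answers (wins_I D)"

definition sR_col_winning_strategy ::
  "(nat \<times> nat) filter \<Rightarrow> nat \<Rightarrow> ((nat \<times> nat) set \<Rightarrow> nat) \<Rightarrow>
     (answer list \<Rightarrow> (nat \<times> nat) set) \<Rightarrow> bool" where
  "sR_col_winning_strategy D m f =
     winning_strategy_I (\<lambda>n. members_on tri_index D)
       (\<lambda>n A. {(i, a) \<in> sR_answers n A. homogeneous f m a})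
       (wins_I D)"

definition aR_winning_strategy ::
  "(nat \<times> nat) filter \<Rightarrow>
     (answer list \<Rightarrow> (nat \<times> nat) set \<times> nat \<times> ((nat \<times> nat) set \<Rightarrow> nat)) \<Rightarrow> bool" where
  "aR_winning_strategy D =
     winning_strategy_I
       (\<lambda>n. {(A, L, f). A \<in> members_on tri_index D \<and> f \<in> colourings n L})
       (\<lambda>n (A, L, f). {(i, a) \<in> sR_answers n A. homogeneous f n a})
       (wins_I D)"

definition semi_Ramsey :: "(nat \<times> nat) filter \<Rightarrow> bool" where
  "semi_Ramsey D \<longleftrightarrow> (\<nexists>\<sigma>. sR_winning_strategy D \<sigma>)"

definition almost_Ramsey :: "(nat \<times> nat) filter \<Rightarrow> bool" where
  "almost_Ramsey D \<longleftrightarrow> semi_Ramsey D \<and>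
     (\<forall>n L. \<forall>f\<in>colourings n L. \<exists>A\<in>members_on tri_index D. \<forall>i. homogeneous f n (A \<inter> tri_column i))"

end

theory Submission
  imports Defs
begin

text \<open>
  (a) to (b): in \<open>G\<^sup>s\<^sup>R\<close> Player I can shrink each \<open>A\<^sub>n\<close> to a member of the filter that is homogeneous
  for \<open>f\<^sub>n\<close> on every column, so every answer of Player II is legal in \<open>G\<^sup>a\<^sup>R\<close>.
  (b) to (c): in \<open>G\<^sup>a\<^sup>R\<close> Player I can play the fixed colouring \<open>f\<close> at every move.
  (c) to (a): unless the ultrafilter is principal, Player I can forbid all columns named earlier by
  Player II. As this strategy does not win, some play produces a set in the ultrafilter each
  of whose columns comes from a single answer, hence is homogeneous for \<open>f\<close>.
\<close>

text \<open>Player I replaces each move of \<open>\<sigma>\<close> by one that leaves Player II no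
  new answers. A play of the new game is then, answer for answer, a play against
  \<open>\<sigma>\<close>, and \<open>W\<close> depends only on the answers.\<close>

lemma winning_strategy_I_transfer:
  assumes win: "winning_strategy_I M R W \<sigma>"
    and sim: "\<And>n x. x \<in> M n \<Longrightarrow> \<exists>x'\<in>M' n. R' n x' \<subseteq> R n x"
  shows "\<exists>\<tau>. winning_strategy_I M' R' W \<tau>"
proof -
  define g where "g n x = (SOME x'. x' \<in> M' n \<and> R' n x' \<subseteq> R n x)" for n x
  have g: "g n x \<in> M' n \<and> R' n (g n x) \<subseteq> R n x" if "x \<in> M n" for n x
    unfolding g_def by (rule someI_ex) (use sim[OF that] in blast)
  define \<tau> where "\<tau> ys = g (length ys) (\<sigma> ys)" for ys
  \<comment> \<open>\<open>g\<close> controls the answers only where \<open>\<sigma>\<close> moves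
    legally, and \<open>\<sigma>\<close> need do so only after legal histories. Hence the induction
    on the length of the history.\<close>
  have move: "\<sigma> ys \<in> M (length ys)"
    if "\<forall>n<length ys. ys ! n \<in> R' n (\<tau> (take n ys))" for ys
    using that
  proof (induction "length ys" arbitrary: ys rule: less_induct)
    case less
    have "ys ! n \<in> R n (\<sigma> (take n ys))" if n: "n < length ys" for n
    proof -
      have "\<sigma> (take n ys) \<in> M n"
        using less.hyps[of "take n ys"] less.prems n by (simp add: min_def)
      then show ?thesis
        using g[of "\<sigma> (take n ys)" n] less.prems n by (auto simp: \<tau>_def min_def)
    qed
    then show ?case
      using win unfolding winning_strategy_I_def by blast
  qed
  have "y \<in> W" if y: "\<And>n. y n \<in> R' n (\<tau> (map y [0..<n]))" for y
  proof -
    have "y n \<in> R n (\<sigma> (map y [0..<n]))" for n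
    proof -
      have "\<sigma> (map y [0..<n]) \<in> M n"
        using move[of "map y [0..<n]"] y by (simp add: take_map)
      then show ?thesis
        using g[of "\<sigma> (map y [0..<n])" n] y[of n] by (auto simp: \<tau>_def)
    qed
    then show ?thesis
      using win unfolding winning_strategy_I_def by blast
  qed
  moreover have "\<tau> ys \<in> M' (length ys)"
    if "\<forall>n<length ys. ys ! n \<in> R' n (\<tau> (take n ys))" for ys
    using g move[OF that] by (simp add: \<tau>_def)
  ultimately show ?thesis
    unfolding winning_strategy_I_def by blast
qed

lemma homogeneous_subset:
  assumes "homogeneous f n B" "A \<subseteq> B"
  shows "homogeneous f n A"
  using assms nsets_mono[OF assms(2)] constant_on_subset unfolding homogeneous_def by metis

text \<open>Such a set has at most one subset of each size.\<close>

lemma homogeneous_subsingleton: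
  assumes "A \<subseteq> {p}"
  shows "homogeneous f n A"
proof -
  have "x = y" if "x \<in> [A]\<^bsup>k\<^esup>" "y \<in> [A]\<^bsup>k\<^esup>" for x y k
    using that assms by (auto simp: nsets_def dest!: subset_singletonD)
  then show ?thesis
    unfolding homogeneous_def constant_on_def by metis
qed

lemma members_on_Int:
  assumes "A \<in> members_on X D" "B \<in> members_on X D"
  shows "A \<inter> B \<in> members_on X D"
  using assms by (auto simp: members_on_def eventually_conj_iff)

text \<open>Otherwise all the complements hold eventually; finitely many of them can be intersected,
  and the result misses the union, forcing \<open>D = bot\<close>.\<close>

lemma ultrafilter_on_UN:
  assumes U: "ultrafilter_on X D" and fin: "finite I"
    and sub: "(\<Union>i\<in>I. F i) \<in> members_on X D"
  shows "\<exists>i\<in>I. F i \<in> members_on X D"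
proof (rule ccontr)
  assume no: "\<not> ?thesis"
  have FX: "F i \<subseteq> X" if "i \<in> I" for i
    using sub that by (auto simp: members_on_def)
  have "\<forall>i\<in>I. X - F i \<in> members_on X D"
    using U no FX unfolding ultrafilter_on_def by blast
  then have "\<forall>\<^sub>F x in D. \<forall>i\<in>I. x \<in> X - F i"
    using fin by (simp add: eventually_ball_finite_distrib members_on_def)
  moreover have "\<forall>\<^sub>F x in D. x \<in> (\<Union>i\<in>I. F i)"
    using sub by (simp add: members_on_def)
  ultimately have "\<forall>\<^sub>F x in D. False"
    by eventually_elim auto
  then show False
    using U by (simp add: ultrafilter_on_def trivial_limit_def)
qed

lemma almost_Ramsey_no_aR_winning_strategy:
  assumes "almost_Ramsey D"
  shows "\<not> aR_winning_strategy D \<sigma>"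
proof
  assume win: "aR_winning_strategy D \<sigma>"
  have "\<exists>\<tau>. sR_winning_strategy D \<tau>"
    unfolding sR_winning_strategy_def
  proof (rule winning_strategy_I_transfer[OF win[unfolded aR_winning_strategy_def]])
    fix n x
    assume "x \<in> {(A, L, f). A \<in> members_on tri_index D \<and> f \<in> colourings n L}"
    then obtain A L f where x: "x = (A, L, f)" and A: "A \<in> members_on tri_index D"
      and f: "f \<in> colourings n L"
      by auto
    obtain B where B: "B \<in> members_on tri_index D"
      and hom: "\<And>i. homogeneous f n (B \<inter> tri_column i)"
      using assms f unfolding almost_Ramsey_def by blast
    \<comment> \<open>Every answer lies in a single column, so homogeneity of \<open>B\<close>
      column by column suffices.\<close>
    have "homogeneous f n a" if "a \<in> nsets_le (A \<inter> B \<inter> tri_column i) n" for a i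
      by (rule homogeneous_subset[OF hom[of i]]) (use that in \<open>auto simp: nsets_le_def nsets_def\<close>)
    moreover have "nsets_le (A \<inter> B \<inter> tri_column i) n \<subseteq> nsets_le (A \<inter> tri_column i) n" for i
      by (auto simp: nsets_le_def nsets_def)
    ultimately have "sR_answers n (A \<inter> B)
        \<subseteq> (case x of (A, L, f) \<Rightarrow> {(i, a) \<in> sR_answers n A. homogeneous f n a})"
      by (auto simp: x sR_answers_def)
    then show "\<exists>x'\<in>members_on tri_index D. sR_answers n x'
        \<subseteq> (case x of (A, L, f) \<Rightarrow> {(i, a) \<in> sR_answers n A. homogeneous f n a})"
      using members_on_Int[OF A B] by blast
  qed
  then show False
    using assms by (simp add: almost_Ramsey_def semi_Ramsey_def)
qed

lemma sR_col_winning_strategy_imp_aR: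
  assumes f: "f \<in> colourings m L" and win: "sR_col_winning_strategy D m f \<sigma>"
  shows "\<exists>\<tau>. aR_winning_strategy D \<tau>"
proof -
  \<comment> \<open>At move \<open>n\<close> Player I must colour sets of size up to
    \<open>n\<close>, whereas \<open>f\<close> is controlled only up to size \<open>m\<close>;
    larger sets get the default 0.\<close>
  define g where "g a = (if card a \<le> m then f a else 0)" for a
  \<comment> \<open>The empty set receives a colour below \<open>L\<close>, so \<open>L\<close> is
    positive and 0 is a legal colour.\<close>
  have "{} \<in> (\<Union>i. nsets_le (tri_column i) m)"
    by (auto simp: nsets_le_def nsets_def)
  then have "0 < L"
    using f unfolding colourings_def by force
  then have g: "g \<in> colourings n L" for n
    using f by (auto simp: colourings_def g_def nsets_le_def nsets_def Pi_iff)
  have hom: "homogeneous f m a" if a: "a \<in> nsets_le X n" and ga: "homogeneous g n a"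
    for a X n
    unfolding homogeneous_def
  proof (intro allI impI)
    fix k assume k: "k \<le> m"
    show "f constant_on [a]\<^bsup>k\<^esup>"
    proof (cases "k \<le> n")
      case True
      then have "g constant_on [a]\<^bsup>k\<^esup>"
        using ga by (simp add: homogeneous_def)
      moreover have "g b = f b" if "b \<in> [a]\<^bsup>k\<^esup>" for b
        using that k by (simp add: g_def nsets_def)
      ultimately show ?thesis
        by (simp add: constant_on_def)
    next
      \<comment> \<open>Here \<open>k > n\<close>, while an answer at move \<open>n\<close> has at
        most \<open>n\<close> elements.\<close>
      case False
      then have "[a]\<^bsup>k\<^esup> = {}"
        using a by (auto simp: nsets_le_def nsets_def dest: card_mono)
      then show ?thesis
        by (simp add: constant_on_def)
    qed
  qed
  show ?thesis
    unfolding aR_winning_strategy_def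
  proof (rule winning_strategy_I_transfer[OF win[unfolded sR_col_winning_strategy_def]])
    fix n A
    assume "A \<in> members_on tri_index D"
    then show "\<exists>x'\<in>{(A, L, f). A \<in> members_on tri_index D \<and> f \<in> colourings n L}.
        (case x' of (A, L, f) \<Rightarrow> {(i, a) \<in> sR_answers n A. homogeneous f n a})
        \<subseteq> {(i, a) \<in> sR_answers n A. homogeneous f m a}"
      using g hom by (intro bexI[of _ "(A, L, g)"]) (auto simp: sR_answers_def)
  qed
qed

lemma homogeneous_member_if_no_sR_col_winning_strategy:
  assumes U: "ultrafilter_on tri_index D"
    and no_win: "\<nexists>\<sigma>. sR_col_winning_strategy D m f \<sigma>"
  shows "\<exists>A\<in>members_on tri_index D. \<forall>i. homogeneous f m (A \<inter> tri_column i)"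
proof (cases "\<exists>i. tri_column i \<in> members_on tri_index D")
  case True
  \<comment> \<open>A finite column in the ultrafilter splits into points, so some singleton belongs
    to it; that singleton is the required set.\<close>
  then obtain i where "(\<Union>p\<in>tri_column i. {p}) \<in> members_on tri_index D"
    by auto
  moreover have "finite (tri_column i)"
    by (simp add: tri_column_def)
  ultimately obtain p where "{p} \<in> members_on tri_index D"
    using ultrafilter_on_UN[OF U] by blast
  then show ?thesis
    by (meson Int_lower1 homogeneous_subsingleton)
next
  case False
  define \<sigma> :: "answer list \<Rightarrow> (nat \<times> nat) set"
    where "\<sigma> ys = tri_index - (\<Union>p\<in>set ys. tri_column (fst p))" for ys
  have "(\<Union>p\<in>set ys. tri_column (fst p)) \<notin> members_on tri_index D" for ys :: "answer list"
    using ultrafilter_on_UN[OF U, of "set ys" "\<lambda>p. tri_column (fst p)"] False by blast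
  moreover have "(\<Union>p\<in>set ys. tri_column (fst p)) \<subseteq> tri_index" for ys :: "answer list"
    by (auto simp: tri_index_def)
  ultimately have "\<sigma> ys \<in> members_on tri_index D" for ys
    using U unfolding ultrafilter_on_def \<sigma>_def by blast
  moreover have "\<not> sR_col_winning_strategy D m f \<sigma>"
    using no_win by blast
  \<comment> \<open>All moves of \<open>\<sigma>\<close> are legal, so it can fail only through a
    play whose answers have their union in the ultrafilter.\<close>
  ultimately obtain y where
    y: "\<And>n. y n \<in> {(i, a) \<in> sR_answers n (\<sigma> (map y [0..<n])). homogeneous f m a}"
    and "y \<notin> wins_I D"
    unfolding sR_col_winning_strategy_def winning_strategy_I_def by blast
  then have mem: "(\<Union>n. snd (y n)) \<in> members_on tri_index D"
    by (simp add: wins_I_def)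
  have hom: "homogeneous f m (snd (y n))" for n
    using y[of n] by auto
  have sub: "snd (y n) \<subseteq> \<sigma> (map y [0..<n]) \<inter> tri_column (fst (y n))" for n
    using y[of n] by (auto simp: sR_answers_def nsets_le_def nsets_def)
  have col: "fst (y n) = i" if "p \<in> snd (y n)" "p \<in> tri_column i" for p n i
    using that sub[of n] by (auto simp: tri_column_def)
  \<comment> \<open>The point \<open>p\<close> matters: an empty answer may still name an old
    column.\<close>
  have fresh: "fst (y j) \<noteq> fst (y n)" if "j < n" "p \<in> snd (y n)" for j n p
    using that sub[of n] by (force simp: \<sigma>_def)
  have "homogeneous f m ((\<Union>n. snd (y n)) \<inter> tri_column i)" for i
  proof (cases "\<exists>n p. p \<in> snd (y n) \<inter> tri_column i")
    case True
    then obtain n p where p: "p \<in> snd (y n)" "p \<in> tri_column i"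
      by blast
    \<comment> \<open>If two different moves met column \<open>i\<close>, the later one would be a
      nonempty answer in a forbidden column.\<close>
    have "j = n" if "q \<in> snd (y j)" "q \<in> tri_column i" for q j
      using col[OF p] col[OF that] fresh[OF _ p(1)] fresh[OF _ that(1)]
      by (metis linorder_neqE_nat)
    then have "(\<Union>n. snd (y n)) \<inter> tri_column i \<subseteq> snd (y n)"
      by blast
    then show ?thesis
      by (rule homogeneous_subset[OF hom])
  next
    case False
    then have "(\<Union>n. snd (y n)) \<inter> tri_column i = {}"
      by blast
    then show ?thesis
      by (simp add: homogeneous_subsingleton)
  qed
  then show ?thesis
    using mem by blast
qed

theorem theorem6p2p8:
  fixes D :: "(nat \<times> nat) filter"
  assumes "ultrafilter_on tri_index D" and "semi_Ramsey D"
  shows "(almost_Ramsey D \<longleftrightarrow> (\<nexists>\<sigma>. aR_winning_strategy D \<sigma>)) \<and>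
         ((\<nexists>\<sigma>. aR_winning_strategy D \<sigma>) \<longleftrightarrow>
            (\<forall>m L. \<forall>f\<in>colourings m L. \<nexists>\<sigma>. sR_col_winning_strategy D m f \<sigma>))"
proof -
  let ?a = "almost_Ramsey D"
  let ?b = "\<nexists>\<sigma>. aR_winning_strategy D \<sigma>"
  let ?c = "\<forall>m L. \<forall>f\<in>colourings m L. \<nexists>\<sigma>. sR_col_winning_strategy D m f \<sigma>"
  have "?a \<Longrightarrow> ?b"
    using almost_Ramsey_no_aR_winning_strategy by blast
  moreover have "?b \<Longrightarrow> ?c"
    using sR_col_winning_strategy_imp_aR by blast
  moreover have "?c \<Longrightarrow> ?a"
    unfolding almost_Ramsey_def
    using assms homogeneous_member_if_no_sR_col_winning_strategy by blast
  ultimately show ?thesis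
    by blast
qed

end
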